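(* For every positive integer $n$ there exists a graph $G$ with $\operatorname{re}(G)=\sqrt{2}$ such that $K_n$ is a minor of $G$.
   Context: Graphs are simple, undirected, finite. A graph $H$ is a minor of $G$ if $H$ can be obtained from $G$ by a sequence of vertex deletions, edge deletions and edge contractions. A (planar) representation of a graph $G=(V,E)$ is a function $\rho:V\to\mathbb{R}^2$; $d$ denotes Euclidean distance; $\rho$ is non-vertex-degenerate (NVD) if it is injective. $V_2(G)$ is the set of 2-element subsets of $V$. Define $\operatorname{re}(G)=\min_\rho \frac{\max_{uv\in E}d(\rho(u),\rho(v))}{\min_{uv\in V_2(G)}d(\rho(u),\rho(v))}$ over NVD representations $\rho$. *)

theory Defs
  imports
    "HOL-Analysis.Analysis"
    "Graph_Theory.Kuratowski"
    "Graph_Theory.Digraph_Isomorphism"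
begin

text \<open>
  A simple undirected finite graph is a \<^locale>\<open>pair_graph\<close>: an undirected edge \<open>uv\<close> is the pair of
  arcs \<open>(u, v)\<close> and \<open>(v, u)\<close>, so each operation below acts on both arcs.
\<close>

subsection \<open>Minors\<close>

definition delete_vertex :: "'a pair_pre_digraph \<Rightarrow> 'a \<Rightarrow> 'a pair_pre_digraph" where
  "delete_vertex G v =
    \<lparr>pverts = pverts G - {v}, parcs = {(x, y) \<in> parcs G. x \<noteq> v \<and> y \<noteq> v}\<rparr>"

definition delete_edge :: "'a pair_pre_digraph \<Rightarrow> 'a \<Rightarrow> 'a \<Rightarrow> 'a pair_pre_digraph" where
  "delete_edge G u v = \<lparr>pverts = pverts G, parcs = parcs G - {(u, v), (v, u)}\<rparr>"

text \<open>
  Contraction identifies \<open>v\<close> with \<open>u\<close> and reuses the name \<open>u\<close> for the merged vertex; the loop is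
  discarded, and parallel edges collapse because \<^const>\<open>parcs\<close> is a set.
\<close>
definition contract_edge :: "'a pair_pre_digraph \<Rightarrow> 'a \<Rightarrow> 'a \<Rightarrow> 'a pair_pre_digraph" where
  "contract_edge G u v =
    (let r = (\<lambda>x. if x = v then u else x)
     in \<lparr>pverts = r ` pverts G, parcs = {(r x, r y) |x y. (x, y) \<in> parcs G \<and> r x \<noteq> r y}\<rparr>)"

inductive minor_step :: "'a pair_pre_digraph \<Rightarrow> 'a pair_pre_digraph \<Rightarrow> bool" where
  delete_vertex: "v \<in> pverts G \<Longrightarrow> minor_step G (delete_vertex G v)"
| delete_edge: "(u, v) \<in> parcs G \<Longrightarrow> minor_step G (delete_edge G u v)"
| contract_edge: "(u, v) \<in> parcs G \<Longrightarrow> minor_step G (contract_edge G u v)"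

definition is_minor :: "'b pair_pre_digraph \<Rightarrow> 'a pair_pre_digraph \<Rightarrow> bool" where
  "is_minor H G \<longleftrightarrow> (\<exists>H'. minor_step\<^sup>*\<^sup>* G H' \<and> digraph_iso (with_proj H') (with_proj H))"

lemma pair_graph_minor_step:
  assumes "minor_step G H" and "pair_graph G"
  shows "pair_graph H"
proof -
  interpret pair_graph G by fact
  have sym: "(y, x) \<in> parcs G" if "(x, y) \<in> parcs G" for x y
    using pair_sym_arcs that by (auto simp: symmetric_def elim: symE)
  have fin: "finite (parcs G)" "finite (pverts G)"
    by (fact pair_finite_arcs, fact pair_finite_verts)
  have *: "{(f x, f y) |x y. (x, y) \<in> parcs G \<and> f x \<noteq> f y} \<subseteq> map_prod f f ` parcs G" for f :: "'a \<Rightarrow> 'a"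
    by force
  from assms(1) show ?thesis
  proof cases
    case (delete_vertex v)
    show ?thesis unfolding delete_vertex delete_vertex_def
      using fin sym
      by unfold_locales
        (auto simp: symmetric_def sym_def no_loops in_arcsD1 in_arcsD2 dest: pair_no_loops intro: finite_subset[OF _ fin(1)])
  next
    case (delete_edge u v)
    show ?thesis unfolding delete_edge delete_edge_def
      using fin sym
      by unfold_locales
        (auto simp: symmetric_def sym_def in_arcsD1 in_arcsD2 dest: pair_no_loops)
  next
    case (contract_edge u v)
    define r where "r = (\<lambda>x. if x = v then u else x)"
    have H: "H = \<lparr>pverts = r ` pverts G, parcs = {(r x, r y) |x y. (x, y) \<in> parcs G \<and> r x \<noteq> r y}\<rparr>"
      unfolding contract_edge contract_edge_def r_def Let_def ..
    have "finite (parcs H)" "finite (pverts H)"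
      using fin finite_subset[OF * finite_imageI[OF fin(1)]] by (simp_all add: H)
    moreover have "x \<in> pverts H \<and> y \<in> pverts H \<and> x \<noteq> y \<and> (y, x) \<in> parcs H"
      if "(x, y) \<in> parcs H" for x y
    proof -
      from that obtain a b where ab: "x = r a" "y = r b" "(a, b) \<in> parcs G" "r a \<noteq> r b"
        unfolding H by auto
      with sym[OF ab(3)] in_arcsD1[OF ab(3)] in_arcsD2[OF ab(3)] show ?thesis
        unfolding H by simp metis
    qed
    ultimately show ?thesis
      by unfold_locales (auto simp: symmetric_def sym_def)
  qed
qed

subsection \<open>Planar representations\<close>

definition nvd :: "'a pair_pre_digraph \<Rightarrow> ('a \<Rightarrow> real^2) \<Rightarrow> bool" where
  "nvd G \<rho> \<longleftrightarrow> inj_on \<rho> (pverts G)"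

definition edge_ratio :: "'a pair_pre_digraph \<Rightarrow> ('a \<Rightarrow> real^2) \<Rightarrow> real" where
  "edge_ratio G \<rho> =
    Max {dist (\<rho> u) (\<rho> v) |u v. (u, v) \<in> parcs G} /
    Min {dist (\<rho> u) (\<rho> v) |u v. u \<in> pverts G \<and> v \<in> pverts G \<and> u \<noteq> v}"

text \<open>
  \<^const>\<open>Least\<close> rather than \<^const>\<open>Inf\<close>: an equation \<open>re G = r\<close> then asserts an attained minimum.
  Without edges the numerator is unspecified.
\<close>
definition re :: "'a pair_pre_digraph \<Rightarrow> real" where
  "re G = (LEAST r. \<exists>\<rho>. nvd G \<rho> \<and> r = edge_ratio G \<rho>)"

end

theory Submission
  imports Defs
begin

text \<open>
  The lattice points \<open>(a, b)\<close> with \<open>0 \<le> a, b < 2N\<close> and \<open>a + b\<close> even have minimum distance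
  \<open>\<surd>2\<close>; joining those at distance at most \<open>2\<close> gives a graph with a drawing of ratio \<open>\<surd>2\<close>.
  The ratio cannot be smaller because the graph contains a \<open>K\<^sub>4\<close>: four points of the plane are
  affinely dependent, \<open>\<Sum> u\<^sub>x x = 0\<close> with \<open>\<Sum> u\<^sub>x = 0\<close>, which gives
  \<open>\<Sum> u\<^sub>x u\<^sub>y \<bar>x - y\<bar>\<^sup>2 = 0\<close>, and this bounds the ratio of the distances from below.

  The vertices with both coordinates even are used for vertical lines and those with both
  coordinates odd for horizontal lines, so these lines cross without sharing vertices. The
  vertical line \<open>a = 2i\<close> together with the horizontal line \<open>b = 2i + 1\<close> is a connected set
  \<open>B\<^sub>i\<close>. The sets \<open>B\<^sub>i\<close> partition the vertices, and any two are adjacent at a crossing;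
  contracting each of them gives \<open>K\<^sub>N\<close>.
\<close>

subsection \<open>Distances in affinely dependent sets\<close>

text \<open>Expanding |x - y|^2 = x.x + y.y - 2 x.y splits the double sum into products, each with a
  factor \<open>sum u S\<close> or the weighted vector sum, and both vanish.\<close>

lemma sum_weighted_dist_squared_eq_0:
  fixes S :: "'a::real_inner set"
  assumes "sum u S = 0" and "(\<Sum>v\<in>S. u v *\<^sub>R v) = 0"
  shows "(\<Sum>x\<in>S. \<Sum>y\<in>S. u x * u y * (dist x y)\<^sup>2) = 0"
proof -
  have "u x * u y * (dist x y)\<^sup>2 =
      (u x * (x \<bullet> x)) * u y + u x * (u y * (y \<bullet> y)) - 2 * ((u x *\<^sub>R x) \<bullet> (u y *\<^sub>R y))" for x y
    by (simp add: dist_norm power2_norm_eq_inner inner_diff inner_commute algebra_simps)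
  then have "(\<Sum>x\<in>S. \<Sum>y\<in>S. u x * u y * (dist x y)\<^sup>2) =
      (\<Sum>x\<in>S. u x * (x \<bullet> x)) * sum u S + sum u S * (\<Sum>y\<in>S. u y * (y \<bullet> y))
      - 2 * ((\<Sum>x\<in>S. u x *\<^sub>R x) \<bullet> (\<Sum>y\<in>S. u y *\<^sub>R y))"
    unfolding sum_product inner_sum_left unfolding inner_sum_right
    by (simp only: sum.distrib sum_subtractf flip: sum_distrib_left)
  then show ?thesis
    using assms by simp
qed

text \<open>In the vanishing weighted sum, each squared distance is replaced by
  \<open>M\<^sup>2\<close> or \<open>m\<^sup>2\<close> according to the sign of its weight;
  Cauchy-Schwarz then removes the weights. Four points give 2 m^2 <= M^2, with equality for a
  square.\<close>

lemma affine_dependent_dist_bound: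
  fixes S :: "'a::real_inner set"
  assumes S: "finite S" "affine_dependent S" and "0 \<le> m"
    and le: "\<And>x y. x \<in> S \<Longrightarrow> y \<in> S \<Longrightarrow> x \<noteq> y \<Longrightarrow> m \<le> dist x y \<and> dist x y \<le> M"
  shows "real (card S) * m\<^sup>2 \<le> (real (card S) - 2) * M\<^sup>2"
proof -
  obtain u where u: "sum u S = 0" "\<exists>v\<in>S. u v \<noteq> 0" "(\<Sum>v\<in>S. u v *\<^sub>R v) = 0"
    using S affine_dependent_explicit_finite by blast
  define T where "T = (\<Sum>x\<in>S. \<bar>u x\<bar>)"
  define Q where "Q = (\<Sum>x\<in>S. (u x)\<^sup>2)"
  obtain v where v: "v \<in> S" "u v \<noteq> 0"
    using u(2) by blast
  have "T > 0"
    unfolding T_def using v S(1) by (intro sum_pos2[of _ v]) auto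
  \<comment> \<open>For p = \<open>u x * u y\<close>, the first two terms equal 2 M^2 p if p >= 0
    and 2 m^2 p otherwise, so one formula covers both signs. The last term cancels them on the
    diagonal, where the distance is 0.\<close>
  have *: "u x * u y * (dist x y)\<^sup>2 * 2 \<le>
      (M\<^sup>2 + m\<^sup>2) * (u x * u y) + (M\<^sup>2 - m\<^sup>2) * (\<bar>u x\<bar> * \<bar>u y\<bar>)
      - (if x = y then 2 * M\<^sup>2 * (u x)\<^sup>2 else 0)" if "x \<in> S" "y \<in> S" for x y
  proof (cases "x = y")
    case True
    then show ?thesis by (simp add: power2_eq_square algebra_simps)
  next
    case False
    with le[OF that] \<open>0 \<le> m\<close> have d: "m\<^sup>2 \<le> (dist x y)\<^sup>2" "(dist x y)\<^sup>2 \<le> M\<^sup>2"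
      by (auto intro: power_mono)
    show ?thesis
    proof (cases "u x * u y \<ge> 0")
      case True
      with mult_left_mono[OF d(2) True] False show ?thesis
        by (simp add: algebra_simps flip: abs_mult)
    next
      case neg: False
      then have "u x * u y \<le> 0" by simp
      from mult_left_mono_neg[OF d(1) this] False neg show ?thesis
        by (simp add: algebra_simps flip: abs_mult)
    qed
  qed
  have "0 = (\<Sum>x\<in>S. \<Sum>y\<in>S. u x * u y * (dist x y)\<^sup>2 * 2)"
    using sum_weighted_dist_squared_eq_0[OF u(1,3)] by (simp flip: sum_distrib_right)
  also have "\<dots> \<le> (\<Sum>x\<in>S. \<Sum>y\<in>S. (M\<^sup>2 + m\<^sup>2) * (u x * u y) + (M\<^sup>2 - m\<^sup>2) * (\<bar>u x\<bar> * \<bar>u y\<bar>)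
      - (if x = y then 2 * M\<^sup>2 * (u x)\<^sup>2 else 0))"
    by (intro sum_mono *)
  also have "\<dots> = (M\<^sup>2 + m\<^sup>2) * (sum u S * sum u S) + (M\<^sup>2 - m\<^sup>2) * (T * T) - 2 * M\<^sup>2 * Q"
    unfolding sum_product T_def Q_def using S(1)
    by (simp add: sum.distrib sum_subtractf flip: sum_distrib_left)
  finally have "2 * M\<^sup>2 * Q \<le> (M\<^sup>2 - m\<^sup>2) * T\<^sup>2"
    using u(1) by (simp add: power2_eq_square)
  moreover have "T\<^sup>2 \<le> Q * card S"
    unfolding T_def Q_def using sum_squared_le_sum_of_squares[of "\<lambda>x. \<bar>u x\<bar>" S] by simp
  ultimately have "2 * M\<^sup>2 * T\<^sup>2 \<le> (M\<^sup>2 - m\<^sup>2) * T\<^sup>2 * card S"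
    by (smt (verit) mult.assoc mult.commute mult_left_mono mult_right_mono of_nat_0_le_iff zero_le_power2)
  then have "T\<^sup>2 * (2 * M\<^sup>2) \<le> T\<^sup>2 * ((M\<^sup>2 - m\<^sup>2) * card S)"
    by (simp add: algebra_simps)
  then have "2 * M\<^sup>2 \<le> (M\<^sup>2 - m\<^sup>2) * card S"
    using \<open>T > 0\<close> by simp
  then show ?thesis
    by (simp add: algebra_simps)
qed

section \<open>Lower bound on the edge ratio of graphs with a 4-clique\<close>

lemma (in pair_graph) finite_edge_lengths: "finite {dist (\<rho> u) (\<rho> v) |u v. (u, v) \<in> parcs G}"
proof -
  have "{dist (\<rho> u) (\<rho> v) |u v. (u, v) \<in> parcs G} = (\<lambda>(u, v). dist (\<rho> u) (\<rho> v)) ` parcs G"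
    by force
  then show ?thesis
    by (simp add: pair_finite_arcs)
qed

lemma (in pair_graph) finite_vertex_distances:
  "finite {dist (\<rho> u) (\<rho> v) |u v. u \<in> pverts G \<and> v \<in> pverts G \<and> u \<noteq> v}"
proof -
  have "{dist (\<rho> u) (\<rho> v) |u v. u \<in> pverts G \<and> v \<in> pverts G \<and> u \<noteq> v}
      \<subseteq> (\<lambda>(u, v). dist (\<rho> u) (\<rho> v)) ` (pverts G \<times> pverts G)"
    by auto
  then show ?thesis
    by (rule finite_subset) (simp add: pair_finite_verts)
qed

text \<open>Inside a clique every distance is also an edge length, so it lies between the minimum
  and the maximum of the ratio. Four points exceed the plane's limit of three affinely independent
  ones.\<close>

lemma (in pair_graph) edge_ratio_ge_sqrt2:
  assumes "nvd G \<rho>" and C: "C \<subseteq> pverts G" "card C = 4"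
    and clique: "\<And>u v. u \<in> C \<Longrightarrow> v \<in> C \<Longrightarrow> u \<noteq> v \<Longrightarrow> (u, v) \<in> parcs G"
  shows "sqrt 2 \<le> edge_ratio G \<rho>"
proof -
  define D where "D = {dist (\<rho> u) (\<rho> v) |u v. u \<in> pverts G \<and> v \<in> pverts G \<and> u \<noteq> v}"
  define L where "L = {dist (\<rho> u) (\<rho> v) |u v. (u, v) \<in> parcs G}"
  have fin: "finite D" "finite L"
    unfolding D_def L_def by (rule finite_vertex_distances finite_edge_lengths)+
  have inj: "inj_on \<rho> C"
    using assms(1) C(1) unfolding nvd_def by (rule inj_on_subset)
  have bounds: "Min D \<le> dist x y \<and> dist x y \<le> Max L"
    if "x \<in> \<rho> ` C" "y \<in> \<rho> ` C" "x \<noteq> y" for x y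
  proof -
    from that obtain u v where uv: "u \<in> C" "v \<in> C" "u \<noteq> v" "x = \<rho> u" "y = \<rho> v"
      by auto
    then have "dist x y \<in> D" "dist x y \<in> L"
      using C(1) clique unfolding D_def L_def by blast+
    then show ?thesis
      using fin by simp
  qed
  \<comment> \<open>Two distinct vertices make the set of distances nonempty, so that its
    \<open>Min\<close> is attained and positive.\<close>
  obtain u v where uv: "u \<in> C" "v \<in> C" "u \<noteq> v"
    using C(2) card_le_Suc0_iff_eq[of C] by (metis card.infinite numeral_le_one_iff
        One_nat_def semiring_norm(69) zero_neq_numeral)
  then have "D \<noteq> {}"
    using C(1) unfolding D_def by blast
  then have "Min D \<in> D"
    using fin by simp
  then have "Min D > 0"
    using assms(1) unfolding D_def nvd_def by (auto dest: inj_onD)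
  moreover have "\<rho> u \<noteq> \<rho> v"
    using uv inj by (auto dest: inj_onD)
  ultimately have "Max L > 0"
    using bounds[of "\<rho> u" "\<rho> v"] uv by auto
  have card: "card (\<rho> ` C) = 4" "finite (\<rho> ` C)"
    using inj C(2) by (auto simp: card_image intro: card_ge_0_finite)
  then have "affine_dependent (\<rho> ` C)"
    by (intro affine_dependent_biggerset) auto
  from affine_dependent_dist_bound[OF card(2) this less_imp_le[OF \<open>Min D > 0\<close>] bounds]
  have "2 * (Min D)\<^sup>2 \<le> (Max L)\<^sup>2"
    using card(1) by simp
  then have "(sqrt 2 * Min D)\<^sup>2 \<le> (Max L)\<^sup>2"
    by (simp add: power_mult_distrib)
  then have "sqrt 2 * Min D \<le> Max L"
    by (rule power2_le_imp_le) (simp add: \<open>Max L > 0\<close> less_imp_le)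
  then show ?thesis
    using \<open>Min D > 0\<close> unfolding edge_ratio_def D_def[symmetric] L_def[symmetric]
    by (simp add: pos_le_divide_eq)
qed

subsection \<open>Complete minors from partitions into branch sets\<close>

lemma is_minor_if_minor_steps:
  fixes G H :: "'a pair_pre_digraph"
  assumes "pair_graph H" "minor_step\<^sup>*\<^sup>* G H"
  shows "is_minor H G"
proof -
  interpret pair_graph H by fact
  define h :: "('a, 'a \<times> 'a, 'a, 'a \<times> 'a) digraph_isomorphism"
    where "h = \<lparr>iso_verts = id, iso_arcs = id, iso_head = snd, iso_tail = fst\<rparr>"
  have "digraph_isomorphism h"
    unfolding digraph_isomorphism_def h_def by (simp add: wf_digraph_axioms)
  moreover have "with_proj H = app_iso h (with_proj H)"
    unfolding app_iso_def h_def by (simp add: with_proj_def)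
  ultimately show ?thesis
    unfolding is_minor_def digraph_iso_def using assms(2) by blast
qed

text \<open>The fibres of \<open>f\<close> are the branch sets. While some fibre has two vertices,
  connectedness provides an edge inside it; contracting that edge preserves all hypotheses and
  lowers the vertex count. Once \<open>f\<close> is injective, the adjacency hypothesis says that
  the graph is complete.\<close>

lemma contract_branch_sets:
  assumes "pair_graph G"
    and "\<And>x y. x \<in> pverts G \<Longrightarrow> y \<in> pverts G \<Longrightarrow> f x = f y \<Longrightarrow>
      (x, y) \<in> {(a, b). (a, b) \<in> parcs G \<and> f a = f b}\<^sup>*"
    and "\<And>x y. x \<in> pverts G \<Longrightarrow> y \<in> pverts G \<Longrightarrow> f x \<noteq> f y \<Longrightarrow>
      \<exists>(a, b)\<in>parcs G. f a = f x \<and> f b = f y"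
  shows "\<exists>H. minor_step\<^sup>*\<^sup>* G H \<and> K\<^bsub>card (f ` pverts G)\<^esub> (with_proj H)"
  using assms
proof (induction "card (pverts G)" arbitrary: G rule: less_induct)
  case less
  interpret pair_graph G by fact
  note conn = less.prems(2) and adj = less.prems(3)
  show ?case
  proof (cases "inj_on f (pverts G)")
    case True
    have "(x, y) \<in> parcs G" if xy: "x \<in> pverts G" "y \<in> pverts G" "x \<noteq> y" for x y
    proof -
      have "f x \<noteq> f y"
        using True xy by (auto dest: inj_onD)
      then obtain a b where ab: "(a, b) \<in> parcs G" "f a = f x" "f b = f y"
        using adj[OF xy(1,2)] by auto
      then have "a = x" "b = y"
        using True xy in_arcsD1[OF ab(1)] in_arcsD2[OF ab(1)] by (auto dest: inj_onD)
      with ab show ?thesis by simp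
    qed
    then have "K\<^bsub>card (f ` pverts G)\<^esub> (with_proj G)"
      unfolding complete_digraph_pair_def using pair_finite_verts True
      by (auto simp: card_image dest: in_arcsD1 in_arcsD2 pair_no_loops)
    then show ?thesis by blast
  next
    case False
    then obtain x y where xy: "x \<in> pverts G" "y \<in> pverts G" "f x = f y" "x \<noteq> y"
      by (auto simp: inj_on_def)
    \<comment> \<open>The first arc of a path from \<open>x\<close> to \<open>y\<close> within their
      fibre is the one to contract.\<close>
    with conn[OF xy(1-3)] obtain v where xv: "(x, v) \<in> parcs G" "f x = f v"
      by (auto elim: converse_rtranclE)
    then have v: "v \<in> pverts G" "x \<noteq> v"
      using in_arcsD2 pair_no_loops[OF xv(1)] by auto
    define r where "r = (\<lambda>z. if z = v then x else z)"
    define G' where "G' = contract_edge G x v"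
    have G'_verts: "pverts G' = r ` pverts G"
      and G'_arcs: "parcs G' = {(r a, r b) |a b. (a, b) \<in> parcs G \<and> r a \<noteq> r b}"
      by (simp_all add: G'_def contract_edge_def r_def)
    have fr: "f (r z) = f z" for z
      using xv(2) by (simp add: r_def)
    have step: "minor_step G G'"
      unfolding G'_def using xv(1) by (rule minor_step.contract_edge)
    have "pverts G' = pverts G - {v}"
      using xy(1) v by (auto simp: G'_verts r_def)
    then have "card (pverts G') < card (pverts G)"
      using card_Diff1_less[OF pair_finite_verts v(1)] by simp
    moreover have "pair_graph G'"
      by (rule pair_graph_minor_step[OF step less.prems(1)])
    moreover have "(r a, r b) \<in> {(a, b). (a, b) \<in> parcs G' \<and> f a = f b}\<^sup>*"
      if "(a, b) \<in> {(a, b). (a, b) \<in> parcs G \<and> f a = f b}\<^sup>*" for a b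
      using that
    proof (induction rule: rtrancl_induct)
      case (step b c)
      \<comment> \<open>An arc inside a fibre either collapses to a point or survives in
        \<open>G'\<close>, so paths map to paths.\<close>
      then have "r b = r c \<or> (r b, r c) \<in> {(a, b). (a, b) \<in> parcs G' \<and> f a = f b}"
        by (auto simp: G'_arcs fr)
      with step.IH show ?case
        by (auto intro: rtrancl_into_rtrancl)
    qed simp
    then have "(x', y') \<in> {(a, b). (a, b) \<in> parcs G' \<and> f a = f b}\<^sup>*"
      if "x' \<in> pverts G'" "y' \<in> pverts G'" "f x' = f y'" for x' y'
      using that conn by (auto simp: G'_verts fr)
    moreover have "\<exists>(a, b)\<in>parcs G'. f a = f x' \<and> f b = f y'"
      if x'y': "x' \<in> pverts G'" "y' \<in> pverts G'" "f x' \<noteq> f y'" for x' y'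
    proof -
      from x'y' obtain x y where xy: "x \<in> pverts G" "y \<in> pverts G" "f x = f x'" "f y = f y'"
        by (auto simp: G'_verts fr)
      with adj[OF xy(1,2)] x'y'(3) obtain a b where ab: "(a, b) \<in> parcs G" "f a = f x'" "f b = f y'"
        by auto
      with x'y'(3) have "r a \<noteq> r b"
        using fr by metis
      with ab(1) have "(r a, r b) \<in> parcs G'"
        unfolding G'_arcs by blast
      then show ?thesis
        using ab(2,3) by (intro bexI) (auto simp: fr)
    qed
    ultimately obtain H where
      H: "minor_step\<^sup>*\<^sup>* G' H" "K\<^bsub>card (f ` pverts G')\<^esub> (with_proj H)"
      using less.hyps[of G'] by blast
    have "f ` pverts G' = f ` pverts G"
      by (simp add: G'_verts image_image fr)
    with H converse_rtranclp_into_rtranclp[OF step H(1)] show ?thesis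
      by auto
  qed
qed

text \<open>Serves to discard the surplus branch set when the lattice is taken one size larger than
  the desired clique.\<close>

lemma complete_digraph_delete_vertex:
  assumes "K\<^bsub>Suc n\<^esub> (with_proj H)"
  shows "\<exists>H'. minor_step H H' \<and> K\<^bsub>n\<^esub> (with_proj H')"
proof -
  obtain v where v: "v \<in> pverts H"
    using assms unfolding complete_digraph_pair_def by fastforce
  have "K\<^bsub>n\<^esub> (with_proj (delete_vertex H v))"
    using assms v unfolding complete_digraph_pair_def
    by (auto simp: delete_vertex_def)
  with v show ?thesis
    by (intro exI[of _ "delete_vertex H v"] conjI minor_step.delete_vertex)
qed

subsection \<open>The even sublattice graph\<close>

definition lattice_verts :: "nat \<Rightarrow> (nat \<times> nat) set" where
  "lattice_verts N = {(a, b). a < 2 * N \<and> b < 2 * N \<and> even (a + b)}"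

text \<open>Integer values make parity arguments available and keep square roots out of the
  adjacency condition.\<close>

definition sqdist :: "nat \<times> nat \<Rightarrow> nat \<times> nat \<Rightarrow> int" where
  "sqdist p q = (int (fst p) - int (fst q))\<^sup>2 + (int (snd p) - int (snd q))\<^sup>2"

text \<open>Squared distances here are even, so the bound 4 admits exactly the values 2 and 4: these
  are king moves on the square lattice rotated by 45 degrees and scaled by
  \<open>sqrt 2\<close>.\<close>

definition lattice_graph :: "nat \<Rightarrow> nat pair_pre_digraph" where
  "lattice_graph N = \<lparr>pverts = prod_encode ` lattice_verts N,
    parcs = {(prod_encode p, prod_encode q) |p q.
      p \<in> lattice_verts N \<and> q \<in> lattice_verts N \<and> p \<noteq> q \<and> sqdist p q \<le> 4}\<rparr>"

definition lattice_drawing :: "nat \<Rightarrow> real^2" where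
  "lattice_drawing v = vector [real (fst (prod_decode v)), real (snd (prod_decode v))]"

definition branch :: "nat \<Rightarrow> nat" where
  "branch v = (let (a, b) = prod_decode v in if even a then a div 2 else b div 2)"

lemma sqdist_commute: "sqdist p q = sqdist q p"
  by (simp add: sqdist_def power2_commute)

lemma finite_lattice_verts: "finite (lattice_verts N)"
  by (rule finite_subset[of _ "{..<2*N} \<times> {..<2*N}"]) (auto simp: lattice_verts_def)

lemma lattice_arc_iff:
  "(prod_encode p, prod_encode q) \<in> parcs (lattice_graph N) \<longleftrightarrow>
    p \<in> lattice_verts N \<and> q \<in> lattice_verts N \<and> p \<noteq> q \<and> sqdist p q \<le> 4"
  by (simp add: lattice_graph_def del: split_paired_Ex)

lemma pair_graph_lattice_graph: "pair_graph (lattice_graph N)"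
proof -
  have "parcs (lattice_graph N) \<subseteq> pverts (lattice_graph N) \<times> pverts (lattice_graph N)"
    by (auto simp: lattice_graph_def)
  moreover have "finite (pverts (lattice_graph N))"
    by (simp add: lattice_graph_def finite_lattice_verts)
  ultimately have "finite (parcs (lattice_graph N))"
    by (meson finite_SigmaI finite_subset)
  then show ?thesis
    by unfold_locales
      (auto simp: lattice_graph_def finite_lattice_verts symmetric_def sym_def sqdist_commute)
qed

lemma dist_lattice_drawing:
  "dist (lattice_drawing (prod_encode p)) (lattice_drawing (prod_encode q)) = sqrt (sqdist p q)"
  by (simp add: lattice_drawing_def dist_vec_def L2_set_def sum_2 sqdist_def dist_real_def)

text \<open>The two coordinate differences have equal parity, so the sum of their squares is even,
  and it is nonzero.\<close>

lemma sqdist_ge_2: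
  assumes "p \<in> lattice_verts N" "q \<in> lattice_verts N" "p \<noteq> q"
  shows "2 \<le> sqdist p q"
proof -
  have "even (sqdist p q)"
    using assms by (auto simp: lattice_verts_def sqdist_def)
  moreover have "sqdist p q \<noteq> 0"
    using assms(3) by (auto simp: sqdist_def sum_power2_eq_zero_iff prod_eq_iff)
  moreover have "sqdist p q \<ge> 0"
    by (simp add: sqdist_def)
  ultimately show ?thesis
    by presburger
qed

section \<open>The value of \<open>re\<close> on the lattice graph\<close>

lemma nvd_lattice_drawing: "nvd (lattice_graph N) lattice_drawing"
  unfolding nvd_def
proof (rule inj_onI)
  fix u v
  assume "u \<in> pverts (lattice_graph N)" "v \<in> pverts (lattice_graph N)"
    and eq: "lattice_drawing u = lattice_drawing v"
  then obtain p q where "p \<in> lattice_verts N" "q \<in> lattice_verts N"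
    and uv: "u = prod_encode p" "v = prod_encode q"
    by (auto simp: lattice_graph_def)
  moreover have "sqdist p q = 0"
    using eq dist_lattice_drawing[of p q] by (simp add: uv)
  ultimately show "u = v"
    using sqdist_ge_2 by fastforce
qed

text \<open>The longest edge is realised by (0, 0) and (0, 2), which needs \<open>N \<ge> 2\<close>;
  the shortest distance by (0, 0) and (1, 1).\<close>

lemma edge_ratio_lattice_drawing:
  assumes "N \<ge> 2"
  shows "edge_ratio (lattice_graph N) lattice_drawing = sqrt 2"
proof -
  let ?G = "lattice_graph N" and ?d = "\<lambda>u v. dist (lattice_drawing u) (lattice_drawing v)"
  interpret pair_graph ?G by (rule pair_graph_lattice_graph)
  have verts: "(0, 0) \<in> lattice_verts N" "(0, 2) \<in> lattice_verts N" "(1, 1) \<in> lattice_verts N"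
    using assms by (auto simp: lattice_verts_def)
  have "Max {?d u v |u v. (u, v) \<in> parcs ?G} = 2"
  proof (rule Max_eqI[OF finite_edge_lengths])
    fix y assume "y \<in> {?d u v |u v. (u, v) \<in> parcs ?G}"
    then obtain p q where "y = sqrt (sqdist p q)" "sqdist p q \<le> 4"
      by (auto simp: lattice_graph_def dist_lattice_drawing)
    moreover from this(2) have "sqrt (sqdist p q) \<le> sqrt 4"
      by (intro real_sqrt_le_mono) simp
    ultimately show "y \<le> 2" by simp
  next
    have "?d (prod_encode (0, 0)) (prod_encode (0, 2)) = 2"
      by (simp add: dist_lattice_drawing sqdist_def)
    moreover have "(prod_encode (0, 0), prod_encode (0, 2)) \<in> parcs ?G"
      unfolding lattice_arc_iff using verts by (simp add: sqdist_def)
    ultimately show "2 \<in> {?d u v |u v. (u, v) \<in> parcs ?G}"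
      by (metis (mono_tags, lifting) mem_Collect_eq)
  qed
  moreover have "Min {?d u v |u v. u \<in> pverts ?G \<and> v \<in> pverts ?G \<and> u \<noteq> v} = sqrt 2"
  proof (rule Min_eqI[OF finite_vertex_distances])
    fix y assume "y \<in> {?d u v |u v. u \<in> pverts ?G \<and> v \<in> pverts ?G \<and> u \<noteq> v}"
    then obtain p q where "y = sqrt (sqdist p q)" "2 \<le> sqdist p q"
      using sqdist_ge_2 by (auto simp: lattice_graph_def dist_lattice_drawing)
    then show "sqrt 2 \<le> y" by simp
  next
    have "?d (prod_encode (0, 0)) (prod_encode (1, 1)) = sqrt 2"
      by (simp add: dist_lattice_drawing sqdist_def)
    moreover have "prod_encode (0, 0) \<in> pverts ?G" "prod_encode (1, 1) \<in> pverts ?G"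
      using verts by (auto simp: lattice_graph_def)
    moreover have "prod_encode (0, 0) \<noteq> prod_encode (1, 1)"
      by simp
    ultimately show "sqrt 2 \<in> {?d u v |u v. u \<in> pverts ?G \<and> v \<in> pverts ?G \<and> u \<noteq> v}"
      by (metis (mono_tags, lifting) mem_Collect_eq)
  qed
  ultimately show ?thesis
    by (simp add: edge_ratio_def real_div_sqrt)
qed

lemma re_lattice_graph:
  assumes "N \<ge> 2"
  shows "re (lattice_graph N) = sqrt 2"
  unfolding re_def
proof (rule Least_equality)
  show "\<exists>\<rho>. nvd (lattice_graph N) \<rho> \<and> sqrt 2 = edge_ratio (lattice_graph N) \<rho>"
    using nvd_lattice_drawing edge_ratio_lattice_drawing[OF assms] by metis
next
  fix r assume "\<exists>\<rho>. nvd (lattice_graph N) \<rho> \<and> r = edge_ratio (lattice_graph N) \<rho>"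
  then obtain \<rho> where \<rho>: "nvd (lattice_graph N) \<rho>" "r = edge_ratio (lattice_graph N) \<rho>"
    by blast
  \<comment> \<open>A square of side \<open>sqrt 2\<close> and diagonal 2 centred at (2, 1): all six
    pairs are edges, and it fits as soon as \<open>N \<ge> 2\<close>.\<close>
  let ?P = "{(1, 1), (2, 0), (2, 2), (3, 1)} :: (nat \<times> nat) set"
  have P: "?P \<subseteq> lattice_verts N"
    using assms by (auto simp: lattice_verts_def)
  have "sqrt 2 \<le> edge_ratio (lattice_graph N) \<rho>"
  proof (rule pair_graph.edge_ratio_ge_sqrt2[OF pair_graph_lattice_graph \<rho>(1)])
    show "prod_encode ` ?P \<subseteq> pverts (lattice_graph N)"
      using P by (auto simp: lattice_graph_def)
    show "card (prod_encode ` ?P) = 4"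
      by (subst card_image) (auto intro: inj_on_subset[OF inj_prod_encode])
  next
    fix u v assume "u \<in> prod_encode ` ?P" "v \<in> prod_encode ` ?P" "u \<noteq> v"
    then obtain p q where pq: "p \<in> ?P" "q \<in> ?P" "u = prod_encode p" "v = prod_encode q"
      by (elim imageE)
    have "p \<in> lattice_verts N" "q \<in> lattice_verts N"
      by (fact subsetD[OF P pq(1)] subsetD[OF P pq(2)])+
    moreover have "p \<noteq> q"
      using \<open>u \<noteq> v\<close> pq(3,4) by blast
    moreover have "sqdist p q \<le> 4"
      using pq(1,2) by (auto simp: sqdist_def)
    ultimately show "(u, v) \<in> parcs (lattice_graph N)"
      by (simp only: pq(3,4) lattice_arc_iff simp_thms)
  qed
  then show "sqrt 2 \<le> r" by (simp add: \<rho>(2))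
qed

section \<open>Branch sets of the lattice graph\<close>

text \<open>Every vertex of branch set i is reachable inside it from the root (2i, 0), the bottom of
  its vertical line; symmetry then joins any two vertices through the root.\<close>

lemma lattice_branch_connected:
  assumes "x \<in> pverts (lattice_graph N)" "y \<in> pverts (lattice_graph N)" "branch x = branch y"
  shows "(x, y) \<in> {(a, b). (a, b) \<in> parcs (lattice_graph N) \<and> branch a = branch b}\<^sup>*"
proof -
  interpret pair_graph "lattice_graph N" by (rule pair_graph_lattice_graph)
  define R where "R = {(a, b). (a, b) \<in> parcs (lattice_graph N) \<and> branch a = branch b}"
  have "sym R"
    using pair_sym_arcs by (auto simp: R_def symmetric_def sym_def)
  then have sym: "(b, a) \<in> R\<^sup>*" if "(a, b) \<in> R\<^sup>*" for a b
    using that by (meson sym_rtrancl symD)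
  have vertical: "(prod_encode (2 * i, 0), prod_encode (2 * i, 2 * k)) \<in> R\<^sup>*"
    if "i < N" "k < N" for i k
    using that(2)
  proof (induction k)
    case (Suc k)
    then have "(prod_encode (2 * i, 2 * k), prod_encode (2 * i, 2 * Suc k)) \<in> R"
      using that(1) by (auto simp: R_def branch_def lattice_arc_iff lattice_verts_def sqdist_def)
    with Suc show ?case
      by (meson Suc_lessD rtrancl.rtrancl_into_rtrancl)
  qed simp
  have horizontal: "(prod_encode (1, 2 * i + 1), prod_encode (2 * k + 1, 2 * i + 1)) \<in> R\<^sup>*"
    if "i < N" "k < N" for i k
    using that(2)
  proof (induction k)
    case (Suc k)
    then have "(prod_encode (2 * k + 1, 2 * i + 1), prod_encode (2 * Suc k + 1, 2 * i + 1)) \<in> R"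
      using that(1) by (auto simp: R_def branch_def lattice_arc_iff lattice_verts_def sqdist_def)
    with Suc show ?case
      by (meson Suc_lessD rtrancl.rtrancl_into_rtrancl)
  qed simp
  have crossing: "(prod_encode (2 * i, 2 * i), prod_encode (2 * i + 1, 2 * i + 1)) \<in> R"
    if "i < N" for i
    using that by (auto simp: R_def branch_def lattice_arc_iff lattice_verts_def sqdist_def)
  have root: "(prod_encode (2 * branch z, 0), z) \<in> R\<^sup>*" if z_vert: "z \<in> pverts (lattice_graph N)" for z
  proof -
    obtain a b where z: "z = prod_encode (a, b)" "a < 2 * N" "b < 2 * N" "even (a + b)"
      using z_vert by (auto simp: lattice_graph_def lattice_verts_def)
    show ?thesis
    proof (cases "even a")
      case True
      with z(4) obtain i k where "a = 2 * i" "b = 2 * k"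
        by (metis even_add evenE)
      with z vertical[of i k] show ?thesis
        by (simp add: branch_def)
    next
      case False
      with z(4) obtain i k where ab: "a = 2 * k + 1" "b = 2 * i + 1"
        by (metis even_add oddE)
      with z have ik: "i < N" "k < N" by auto
      \<comment> \<open>The path climbs the vertical line to (2i, 2i), steps over to the horizontal
        line, returns to its left end and from there runs out to \<open>z\<close>.\<close>
      have "(prod_encode (2 * i, 0), prod_encode (2 * i + 1, 2 * i + 1)) \<in> R\<^sup>*"
        using vertical[OF ik(1) ik(1)] crossing[OF ik(1)] by (rule rtrancl_into_rtrancl)
      also have "(prod_encode (2 * i + 1, 2 * i + 1), prod_encode (1, 2 * i + 1)) \<in> R\<^sup>*"
        by (rule sym[OF horizontal[OF ik(1) ik(1)]])
      also have "(prod_encode (1, 2 * i + 1), z) \<in> R\<^sup>*"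
        using horizontal[OF ik] by (simp only: z(1) ab)
      finally show ?thesis
        by (simp add: branch_def z(1) ab)
    qed
  qed
  have "(x, prod_encode (2 * branch x, 0)) \<in> R\<^sup>*"
    by (rule sym[OF root[OF assms(1)]])
  also have "(prod_encode (2 * branch x, 0), y) \<in> R\<^sup>*"
    using root[OF assms(2)] assms(3) by simp
  finally show ?thesis
    by (simp only: R_def)
qed

lemma branch_lattice_verts: "branch ` pverts (lattice_graph N) = {..<N}"
proof
  show "branch ` pverts (lattice_graph N) \<subseteq> {..<N}"
    by (auto simp: branch_def lattice_graph_def lattice_verts_def)
  show "{..<N} \<subseteq> branch ` pverts (lattice_graph N)"
  proof
    fix i assume "i \<in> {..<N}"
    then have "prod_encode (2 * i, 0) \<in> pverts (lattice_graph N)"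
      by (auto simp: lattice_graph_def lattice_verts_def)
    moreover have "branch (prod_encode (2 * i, 0)) = i"
      by (simp add: branch_def)
    ultimately show "i \<in> branch ` pverts (lattice_graph N)"
      by force
  qed
qed

text \<open>The vertical line of \<open>i\<close> passes the horizontal line of \<open>j\<close> at
  a diagonal edge of squared length 2.\<close>

lemma lattice_branch_adjacent:
  assumes "i < N" "j < N"
  shows "\<exists>(a, b)\<in>parcs (lattice_graph N). branch a = i \<and> branch b = j"
proof (rule bexI)
  show "(prod_encode (2 * i, 2 * j), prod_encode (2 * i + 1, 2 * j + 1)) \<in> parcs (lattice_graph N)"
    using assms by (auto simp: lattice_arc_iff lattice_verts_def sqdist_def)
qed (simp add: branch_def)

theorem theorem7:
  fixes n :: nat
  assumes "n \<ge> 1"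
  shows "\<exists>G :: nat pair_pre_digraph. pair_graph G \<and> re G = sqrt 2 \<and>
    (\<exists>H :: nat pair_pre_digraph. K\<^bsub>n\<^esub> (with_proj H) \<and> is_minor H G)"
proof -
  \<comment> \<open>\<open>Suc n\<close> rather than \<open>n\<close> guarantees size at least 2
    even for \<open>n = 1\<close>, as \<open>re_lattice_graph\<close> requires; the extra clique
    vertex is deleted afterwards.\<close>
  let ?G = "lattice_graph (Suc n)"
  have "\<exists>H. minor_step\<^sup>*\<^sup>* ?G H \<and> K\<^bsub>card (branch ` pverts ?G)\<^esub> (with_proj H)"
  proof (rule contract_branch_sets[OF pair_graph_lattice_graph lattice_branch_connected])
    fix x y assume "x \<in> pverts ?G" "y \<in> pverts ?G"
    then show "\<exists>(a, b)\<in>parcs ?G. branch a = branch x \<and> branch b = branch y"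
      using branch_lattice_verts[of "Suc n"] by (intro lattice_branch_adjacent) auto
  qed
  then obtain H where "minor_step\<^sup>*\<^sup>* ?G H" "K\<^bsub>Suc n\<^esub> (with_proj H)"
    by (auto simp: branch_lattice_verts)
  then obtain H' where H': "minor_step\<^sup>*\<^sup>* ?G H'" "K\<^bsub>n\<^esub> (with_proj H')"
    using complete_digraph_delete_vertex by (meson rtranclp.rtrancl_into_rtrancl)
  then have "is_minor H' ?G"
    by (intro is_minor_if_minor_steps pair_graphI_complete)
  with H'(2) have "\<exists>H :: nat pair_pre_digraph. K\<^bsub>n\<^esub> (with_proj H) \<and> is_minor H ?G"
    by blast
  moreover have "re ?G = sqrt 2"
    using assms by (intro re_lattice_graph) simp
  ultimately show ?thesis
    using pair_graph_lattice_graph by blast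
qed

end
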